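(* For every positive integer $n$, $$2^{\lfloor n/2 \rfloor}\;\leq\; C(n,2)\;\leq\; 2^{n-1},$$ where $C(n,2)$ denotes the maximum cardinality of a family of directed Hamilton paths in the symmetrically complete digraph $\hat{K}_n$ such that the union of any two distinct members of the family contains a directed cycle of length two.
   Context: The symmetrically complete digraph $\hat{K}_n$ has vertex set $[n]=\{1,\dots,n\}$ and contains both arcs $(i,j)$ and $(j,i)$ for every pair of distinct vertices $i,j$. A directed Hamilton path in $\hat{K}_n$ is a Hamilton path whose edges are oriented consecutively (every in-degree and out-degree in the path is at most 1); thus directed Hamilton paths correspond bijectively to permutations $\pi$ of $[n]$, the path having arcs $(\pi(i),\pi(i+1))$, $1\le i\le n-1$. The union of two digraphs on the same vertex set is the digraph whose arc set is the union of the two arc sets. A directed cycle of length two consists of two oppositely oriented arcs $(i,j)$ and $(j,i)$, $i\ne j$. *)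

theory Defs
  imports "Graph_Theory.Graph_Theory"
begin

definition sym_complete_digraph :: "nat \<Rightarrow> (nat, nat \<times> nat) pre_digraph" where
  "sym_complete_digraph n =
     \<lparr> verts = {1..n}, arcs = {(i, j). i \<in> {1..n} \<and> j \<in> {1..n} \<and> i \<noteq> j},
       tail = fst, head = snd \<rparr>"

lemma complete_digraph_sym_complete_digraph: "complete_digraph n (sym_complete_digraph n)"
proof -
  have "complete_digraph n (with_proj
      \<lparr> pverts = {1..n}, parcs = {(i, j). i \<in> {1..n} \<and> j \<in> {1..n} \<and> i \<noteq> j} \<rparr>)"
    by (subst complete_digraph_pair_def) auto
  then show ?thesis
    by (simp add: with_proj_def sym_complete_digraph_def)
qed

text \<open>
  A directed Hamilton path is a spanning subdigraph, not a list of vertices: two members of a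
  family are distinct iff their arc sets differ. For one vertex, \<open>p\<close> is the empty walk.
\<close>

definition directed_hamilton_path :: "('a, 'b) pre_digraph \<Rightarrow> ('a, 'b) pre_digraph \<Rightarrow> bool" where
  "directed_hamilton_path G H \<longleftrightarrow>
     (\<exists>u p v. pre_digraph.apath G u p v \<and> set (pre_digraph.awalk_verts G u p) = verts G
        \<and> H = \<lparr> verts = verts G, arcs = set p, tail = tail G, head = head G \<rparr>)"

definition contains_dicycle :: "nat \<Rightarrow> ('a, 'b) pre_digraph \<Rightarrow> bool" where
  "contains_dicycle k D \<longleftrightarrow> (\<exists>p. pre_digraph.cycle D p \<and> length p = k)"

definition dicycle_family :: "nat \<Rightarrow> nat \<Rightarrow> (nat, nat \<times> nat) pre_digraph set \<Rightarrow> bool" where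
  "dicycle_family n k F \<longleftrightarrow>
     (\<forall>H\<in>F. directed_hamilton_path (sym_complete_digraph n) H) \<and>
     (\<forall>H1\<in>F. \<forall>H2\<in>F. H1 \<noteq> H2 \<longrightarrow> contains_dicycle k (Digraph_Component.union H1 H2))"

definition max_dicycle_family :: "nat \<Rightarrow> nat \<Rightarrow> nat" where
  "max_dicycle_family n k = Max (card ` {F. dicycle_family n k F})"

text \<open>The maximum ranges over a finite nonempty set, and all families are finite.\<close>

lemma finite_directed_hamilton_paths:
  "finite {H. directed_hamilton_path (sym_complete_digraph n) H}"
proof -
  let ?G = "sym_complete_digraph n"
  have "finite (arcs ?G)"
    by (rule finite_subset[of _ "{1..n} \<times> {1..n}"]) (auto simp: sym_complete_digraph_def)
  moreover have "{H. directed_hamilton_path ?G H} \<subseteq>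
      (\<lambda>A. \<lparr> verts = verts ?G, arcs = A, tail = tail ?G, head = head ?G \<rparr>) ` Pow (arcs ?G)"
    by (auto simp: directed_hamilton_path_def pre_digraph.apath_def pre_digraph.awalk_def)
  ultimately show ?thesis
    by (meson finite_Pow_iff finite_imageI finite_subset)
qed

lemma finite_dicycle_families: "finite {F. dicycle_family n k F}"
  by (rule finite_subset[OF _ finite_Pow_iff[THEN iffD2, OF finite_directed_hamilton_paths[of n]]])
     (auto simp: dicycle_family_def)

lemma dicycle_family_finite: "dicycle_family n k F \<Longrightarrow> finite F"
  by (rule finite_subset[OF _ finite_directed_hamilton_paths[of n]])
     (auto simp: dicycle_family_def)

lemma dicycle_family_empty: "dicycle_family n k {}"
  by (simp add: dicycle_family_def)

lemma contains_dicycle_2_iff: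
  "wf_digraph D \<Longrightarrow> contains_dicycle 2 D \<longleftrightarrow>
     (\<exists>i j. i \<noteq> j \<and> (i, j) \<in> arcs_ends D \<and> (j, i) \<in> arcs_ends D)"
proof -
  assume "wf_digraph D"
  then interpret wf_digraph D .
  show ?thesis
  proof
    assume "contains_dicycle 2 D"
    then obtain p where p: "cycle p" "length p = 2"
      by (auto simp: contains_dicycle_def)
    then obtain e f where "p = [e, f]"
      by (auto simp: length_Suc_conv numeral_2_eq_2)
    with p show "\<exists>i j. i \<noteq> j \<and> (i, j) \<in> arcs_ends D \<and> (j, i) \<in> arcs_ends D"
      by (fastforce simp: cycle_def awalk_def arcs_ends_conv image_iff)
  next
    assume "\<exists>i j. i \<noteq> j \<and> (i, j) \<in> arcs_ends D \<and> (j, i) \<in> arcs_ends D"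
    then obtain e f where "e \<in> arcs D" "f \<in> arcs D" "tail D e \<noteq> head D e"
      "tail D f = head D e" "head D f = tail D e"
      by (auto simp: arcs_ends_conv)
    then have "cycle [e, f]"
      by (auto simp: cycle_def awalk_def)
    then show "contains_dicycle 2 D"
      by (auto simp: contains_dicycle_def intro!: exI[of _ "[e, f]"])
  qed
qed

end

theory Submission
  imports Defs
begin

text \<open>
  Both bounds rest on one observation: a Hamilton path never uses an edge in both directions, so a
  two-cycle in the union of two paths is an edge that the two paths traverse oppositely.

  Upper bound. Choose a tournament on \<open>[n]\<close> uniformly at random. It contains a given Hamilton
  path with probability \<open>2^-(n-1)\<close>, since the \<open>n - 1\<close> arcs prescribe the orientation of
  \<open>n - 1\<close> different edges. No tournament contains two members of the family, because they
  disagree on some edge. The events are therefore disjoint, and there are at most \<open>2^(n-1)\<close>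
  of them. The counting behind this is \<open>card_le_of_conflicting_partial_assignments\<close>, in which a
  path is regarded as a partial 0-1 assignment on the set of edges.

  Lower bound. Cut \<open>1, 2, ..., n\<close> into consecutive blocks of two, leaving the last vertex alone
  if \<open>n\<close> is odd, and reverse an arbitrary subset of the blocks. Two different subsets differ in
  some block, whose inner edge is then traversed in both directions.
\<close>

section \<open>Directed Hamilton paths as vertex sequences\<close>

definition path_digraph :: "'a list \<Rightarrow> ('a, 'a \<times> 'a) pre_digraph" where
  "path_digraph vs =
     \<lparr> verts = set vs, arcs = set (zip vs (tl vs)), tail = fst, head = snd \<rparr>"

lemma path_digraph_simps [simp]:
  "verts (path_digraph vs) = set vs"
  "arcs (path_digraph vs) = set (zip vs (tl vs))"
  "tail (path_digraph vs) = fst"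
  "head (path_digraph vs) = snd"
  by (simp_all add: path_digraph_def)

lemma in_set_zip_tl_iff:
  "(i, j) \<in> set (zip vs (tl vs)) \<longleftrightarrow>
     (\<exists>k. Suc k < length vs \<and> i = vs ! k \<and> j = vs ! Suc k)"
  by (auto simp: set_zip nth_tl less_diff_conv)

text \<open>A vertex sequence without repetition determines the positions of its vertices, and an arc
  and its reverse would put both end vertices before each other.\<close>

lemma no_antiparallel_arcs:
  assumes "distinct vs" "(i, j) \<in> set (zip vs (tl vs))"
  shows "(j, i) \<notin> set (zip vs (tl vs))"
proof
  assume "(j, i) \<in> set (zip vs (tl vs))"
  then obtain k l where "Suc k < length vs" "i = vs ! k" "j = vs ! Suc k"
    "Suc l < length vs" "j = vs ! l" "i = vs ! Suc l"
    using assms(2) unfolding in_set_zip_tl_iff by blast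
  then have "Suc k = l" "k = Suc l"
    using \<open>distinct vs\<close> by (metis Suc_lessD nth_eq_iff_index_eq)+
  then show False by simp
qed

lemma no_loops:
  assumes "distinct vs" "(i, j) \<in> set (zip vs (tl vs))"
  shows "i \<noteq> j"
  using no_antiparallel_arcs[OF assms] assms(2) by blast

lemma card_path_arcs:
  assumes "distinct vs"
  shows "card (set (zip vs (tl vs))) = length vs - 1"
  using assms by (simp add: distinct_card distinct_zipI1)

lemma set_zip_tl_subset: "set (zip vs (tl vs)) \<subseteq> set vs \<times> set vs"
  by (auto simp: in_set_zip_tl_iff)

lemma arcs_eq_zip_awalk_verts:
  assumes "tail G = fst" "head G = snd" "pre_digraph.cas G u p v"
  shows "p = zip (pre_digraph.awalk_verts G u p) (tl (pre_digraph.awalk_verts G u p))"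
  using assms(3)
proof (induction p arbitrary: u)
  case Nil
  then show ?case by (simp add: pre_digraph.awalk_verts.simps)
next
  case (Cons e p)
  then have e: "fst e = u" and walk: "pre_digraph.cas G (snd e) p v"
    by (simp_all add: assms(1,2) pre_digraph.cas.simps)
  let ?vs = "pre_digraph.awalk_verts G (snd e) p"
  obtain ws where ws: "?vs = snd e # ws"
    using walk by (cases p) (simp_all add: assms(1,2) pre_digraph.awalk_verts.simps
      pre_digraph.cas.simps)
  have "zip (u # ?vs) ?vs = e # zip ?vs (tl ?vs)"
    unfolding ws using e by (simp add: prod_eq_iff)
  then show ?case
    using Cons.IH[OF walk] e by (simp add: assms(1,2) pre_digraph.awalk_verts.simps)
qed

lemma awalk_of_vertex_list:
  assumes "tail G = fst" "head G = snd" "vs \<noteq> []"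
  shows "pre_digraph.cas G (hd vs) (zip vs (tl vs)) (last vs)"
    and "pre_digraph.awalk_verts G (hd vs) (zip vs (tl vs)) = vs"
  using assms(3)
  by (induction vs rule: induct_list012)
     (simp_all add: assms pre_digraph.awalk_verts.simps pre_digraph.cas.simps)

lemma directed_hamilton_path_iff:
  assumes "n \<ge> 1"
  shows "directed_hamilton_path (sym_complete_digraph n) H \<longleftrightarrow>
    (\<exists>vs. distinct vs \<and> set vs = {1..n} \<and> H = path_digraph vs)"
proof
  let ?G = "sym_complete_digraph n"
  have G: "tail ?G = fst" "head ?G = snd" "verts ?G = {1..n}"
    by (simp_all add: sym_complete_digraph_def)
  {
    assume "directed_hamilton_path ?G H"
    then obtain u p v where p: "pre_digraph.apath ?G u p v"
      and V: "set (pre_digraph.awalk_verts ?G u p) = {1..n}"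
      and H: "H = \<lparr> verts = {1..n}, arcs = set p, tail = fst, head = snd \<rparr>"
      by (auto simp: directed_hamilton_path_def G)
    let ?vs = "pre_digraph.awalk_verts ?G u p"
    have "distinct ?vs" "p = zip ?vs (tl ?vs)"
      using p arcs_eq_zip_awalk_verts[OF G(1,2)]
      by (auto simp: pre_digraph.apath_def pre_digraph.awalk_def)
    then show "\<exists>vs. distinct vs \<and> set vs = {1..n} \<and> H = path_digraph vs"
      using V H by (auto simp: path_digraph_def intro!: exI[of _ ?vs])
  next
    assume "\<exists>vs. distinct vs \<and> set vs = {1..n} \<and> H = path_digraph vs"
    then obtain vs where vs: "distinct vs" "set vs = {1..n}" "H = path_digraph vs" by blast
    with assms have "vs \<noteq> []" by auto
    note walk = awalk_of_vertex_list[OF G(1,2) this]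
    have "set (zip vs (tl vs)) \<subseteq> arcs ?G"
      using set_zip_tl_subset[of vs] no_loops[OF vs(1)] vs(2)
      by (force simp: sym_complete_digraph_def)
    moreover have "hd vs \<in> verts ?G"
      using \<open>vs \<noteq> []\<close> vs(2) hd_in_set G(3) by metis
    ultimately have "pre_digraph.apath ?G (hd vs) (zip vs (tl vs)) (last vs)"
      using walk vs(1) by (simp add: pre_digraph.apath_def pre_digraph.awalk_def)
    then show "directed_hamilton_path ?G H"
      unfolding directed_hamilton_path_def using walk(2) vs G
      by (intro exI[of _ "hd vs"] exI[of _ "zip vs (tl vs)"] exI[of _ "last vs"])
        (simp add: path_digraph_def)
  }
qed

lemma contains_dicycle_2_union_iff:
  assumes "distinct vs" "distinct ws"
  shows "contains_dicycle 2 (Digraph_Component.union (path_digraph vs) (path_digraph ws)) \<longleftrightarrow>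
    (\<exists>i j. (i, j) \<in> set (zip vs (tl vs)) \<and> (j, i) \<in> set (zip ws (tl ws)))"
proof -
  let ?U = "Digraph_Component.union (path_digraph vs) (path_digraph ws)"
  have wf: "wf_digraph ?U"
    using set_zip_tl_subset[of vs] set_zip_tl_subset[of ws] by unfold_locales auto
  have "arcs_ends ?U = set (zip vs (tl vs)) \<union> set (zip ws (tl ws))"
    by (simp add: arcs_ends_def arc_to_ends_def)
  then show ?thesis
    unfolding contains_dicycle_2_iff[OF wf]
    using no_antiparallel_arcs[OF assms(1)] no_antiparallel_arcs[OF assms(2)]
      no_loops[OF assms(1)] by (metis Un_iff)
qed

section \<open>The upper bound\<close>

text \<open>
  The index \<open>i\<close> stands for the partial 0-1 assignment with value 1 on \<open>A i\<close> and 0 on \<open>B i\<close>.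
  It fixes \<open>m\<close> values, hence has \<open>2^(card E - m)\<close> extensions to all of \<open>E\<close>, and conflicting
  assignments have no common extension among the \<open>2^card E\<close> total assignments.
\<close>

lemma card_le_of_conflicting_partial_assignments:
  assumes "finite E" "finite I"
    and sub: "\<And>i. i \<in> I \<Longrightarrow> A i \<union> B i \<subseteq> E"
    and disj: "\<And>i. i \<in> I \<Longrightarrow> A i \<inter> B i = {}"
    and m: "\<And>i. i \<in> I \<Longrightarrow> card (A i \<union> B i) = m"
    and conflict: "\<And>i j. i \<in> I \<Longrightarrow> j \<in> I \<Longrightarrow> i \<noteq> j \<Longrightarrow> A i \<inter> B j \<noteq> {} \<or> A j \<inter> B i \<noteq> {}"
  shows "card I \<le> 2 ^ m"
proof (cases "I = {}")
  case False
  define X where "X i = {T. A i \<subseteq> T \<and> T \<subseteq> E - B i}" for i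
  have card_X: "card (X i) = 2 ^ (card E - m)" if "i \<in> I" for i
  proof -
    have "X i = (\<lambda>S. A i \<union> S) ` Pow (E - (A i \<union> B i))"
    proof (intro equalityI subsetI)
      fix T assume "T \<in> X i"
      then have "T = A i \<union> (T - A i)" "T - A i \<in> Pow (E - (A i \<union> B i))"
        by (auto simp: X_def)
      then show "T \<in> (\<lambda>S. A i \<union> S) ` Pow (E - (A i \<union> B i))" by blast
    qed (use sub[OF that] disj[OF that] in \<open>auto simp: X_def\<close>)
    moreover have "inj_on (\<lambda>S. A i \<union> S) (Pow (E - (A i \<union> B i)))"
      by (rule inj_onI) blast
    ultimately have "card (X i) = 2 ^ card (E - (A i \<union> B i))"
      using \<open>finite E\<close> by (simp add: card_image card_Pow)
    also have "card (E - (A i \<union> B i)) = card E - m"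
      using sub[OF that] m[OF that] \<open>finite E\<close> by (metis card_Diff_subset finite_subset)
    finally show ?thesis .
  qed
  have fin: "finite (X i)" for i
    by (rule finite_subset[of _ "Pow E"]) (use \<open>finite E\<close> in \<open>auto simp: X_def\<close>)
  have "X i \<inter> X j = {}" if "i \<in> I" "j \<in> I" "i \<noteq> j" for i j
    using conflict[OF that] by (auto simp: X_def)
  then have "card (\<Union>i\<in>I. X i) = card I * 2 ^ (card E - m)"
    using \<open>finite I\<close> fin card_X by (subst card_UN_disjoint) auto
  moreover have "card (\<Union>i\<in>I. X i) \<le> card (Pow E)"
    using \<open>finite E\<close> by (intro card_mono) (auto simp: X_def)
  ultimately have "card I * 2 ^ (card E - m) \<le> 2 ^ card E"
    using \<open>finite E\<close> by (simp add: card_Pow)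
  moreover have "m \<le> card E"
    using False sub m \<open>finite E\<close> by (metis card_mono ex_in_conv)
  ultimately have "card I * 2 ^ (card E - m) \<le> 2 ^ m * 2 ^ (card E - m)"
    by (simp flip: power_add)
  then show ?thesis by simp
qed simp

text \<open>Each edge is represented by its increasing pair. A path assigns 1 to the edges that it
  traverses upwards and 0 to those that it traverses downwards.\<close>

lemma card_dicycle_family_le:
  assumes "n \<ge> 1" "dicycle_family n 2 F"
  shows "card F \<le> 2 ^ (n - 1)"
proof (rule card_le_of_conflicting_partial_assignments)
  define up down where "up H = {(i, j). i < j \<and> (i, j) \<in> arcs H}"
    and "down H = {(i, j). i < j \<and> (j, i) \<in> arcs H}"
    for H :: "(nat, nat \<times> nat) pre_digraph"
  let ?E = "{1..n} \<times> {1..n}"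
  show "finite ?E" "finite F"
    using assms(2) by (simp_all add: dicycle_family_finite)
  have path: "\<exists>vs. distinct vs \<and> set vs = {1..n} \<and> H = path_digraph vs" if "H \<in> F" for H
    using assms that by (simp add: dicycle_family_def directed_hamilton_path_iff)
  fix H assume "H \<in> F"
  then obtain vs where vs: "distinct vs" "set vs = {1..n}" "H = path_digraph vs"
    using path by blast
  note anti = no_antiparallel_arcs[OF vs(1)]
  show "up H \<union> down H \<subseteq> ?E"
    using set_zip_tl_subset[of vs] vs by (auto simp: up_def down_def)
  show "up H \<inter> down H = {}"
    using vs anti by (auto simp: up_def down_def)
  show "card (up H \<union> down H) = n - 1"
  proof -
    let ?sort = "\<lambda>(i, j). (min i j, max i j :: nat)"
    have "up H \<union> down H = ?sort ` arcs H"
      using no_loops[OF vs(1)] vs(3)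
      by (force simp: up_def down_def min_def max_def image_iff split: if_splits)
    moreover have "inj_on ?sort (arcs H)"
      using anti vs(3)
      by (auto simp: inj_on_def min_def max_def split: if_splits)
    moreover have "length vs = n"
      using vs distinct_card by fastforce
    ultimately show ?thesis
      using card_path_arcs[OF vs(1)] vs(3) by (simp add: card_image)
  qed
  fix K assume "K \<in> F" "H \<noteq> K"
  then obtain ws where ws: "distinct ws" "K = path_digraph ws"
    using path by blast
  have "contains_dicycle 2 (Digraph_Component.union H K)"
    using assms(2) \<open>H \<in> F\<close> \<open>K \<in> F\<close> \<open>H \<noteq> K\<close> by (simp add: dicycle_family_def)
  then obtain i j where ij: "(i, j) \<in> arcs H" "(j, i) \<in> arcs K"
    using contains_dicycle_2_union_iff[OF vs(1) ws(1)] vs(3) ws(2) by auto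
  then consider "i < j" | "j < i"
    using no_loops[OF vs(1)] vs(3) by fastforce
  then show "up H \<inter> down K \<noteq> {} \<or> up K \<inter> down H \<noteq> {}"
    by cases (use ij in \<open>auto simp: up_def down_def\<close>)
qed

section \<open>The lower bound\<close>

text \<open>Positions start from 0, so that block \<open>k\<close> consists of the positions \<open>2 * k\<close> and
  \<open>2 * k + 1\<close>.\<close>

definition reverse_blocks :: "nat set \<Rightarrow> nat \<Rightarrow> nat" where
  "reverse_blocks S i =
     (if i div 2 \<in> S then (if even i then i + 1 else i - 1) else i)"

definition block_list :: "nat \<Rightarrow> nat set \<Rightarrow> nat list" where
  "block_list n S = map (\<lambda>i. Suc (reverse_blocks S i)) [0..<n]"

lemma reverse_blocks_involution: "reverse_blocks S (reverse_blocks S i) = i"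
  by (cases "even i") (auto simp: reverse_blocks_def elim!: evenE oddE)

lemma reverse_blocks_less:
  assumes "S \<subseteq> {..<n div 2}" "i < n"
  shows "reverse_blocks S i < n"
proof (cases "i div 2 \<in> S \<and> even i")
  case True
  then have "i div 2 < n div 2" "even i" using assms by auto
  then have "i + 1 < n" by presburger
  then show ?thesis using True by (simp add: reverse_blocks_def)
qed (use assms in \<open>auto simp: reverse_blocks_def\<close>)

lemma distinct_block_list: "distinct (block_list n S)"
  by (auto simp: block_list_def distinct_map inj_on_def) (metis reverse_blocks_involution)

lemma set_block_list:
  assumes "S \<subseteq> {..<n div 2}"
  shows "set (block_list n S) = {1..n}"
proof (rule card_subset_eq)
  show "set (block_list n S) \<subseteq> {1..n}"
    using reverse_blocks_less[OF assms] by (auto simp: block_list_def Suc_le_eq)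
  show "card (set (block_list n S)) = card {1..n}"
    using distinct_card[OF distinct_block_list] by (simp add: block_list_def)
qed simp

lemma block_arc:
  assumes "k < n div 2"
  shows "(if k \<in> S then (2 * k + 2, 2 * k + 1) else (2 * k + 1, 2 * k + 2))
    \<in> set (zip (block_list n S) (tl (block_list n S)))"
proof -
  have "Suc (2 * k) < n" using assms by presburger
  then have "(block_list n S ! (2 * k), block_list n S ! Suc (2 * k))
    \<in> set (zip (block_list n S) (tl (block_list n S)))"
    unfolding in_set_zip_tl_iff by (auto simp: block_list_def simp del: upt_Suc)
  then show ?thesis
    using \<open>Suc (2 * k) < n\<close>
    by (auto simp: block_list_def reverse_blocks_def simp del: upt_Suc split: if_splits)
qed

lemma contains_dicycle_block_lists:
  assumes "S \<subseteq> {..<n div 2}" "T \<subseteq> {..<n div 2}" "S \<noteq> T"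
  shows "contains_dicycle 2 (Digraph_Component.union
    (path_digraph (block_list n S)) (path_digraph (block_list n T)))"
proof -
  obtain k where "k < n div 2" "k \<in> S \<longleftrightarrow> k \<notin> T"
    using assms by blast
  then show ?thesis
    unfolding contains_dicycle_2_union_iff[OF distinct_block_list distinct_block_list]
    using block_arc[of k n S] block_arc[of k n T] by (cases "k \<in> S") auto
qed

lemma exists_dicycle_family_of_card:
  assumes "n \<ge> 1"
  shows "\<exists>F. dicycle_family n 2 F \<and> card F = 2 ^ (n div 2)"
proof (intro exI conjI)
  let ?path = "\<lambda>S. path_digraph (block_list n S)"
  let ?F = "?path ` Pow {..<n div 2}"
  show "dicycle_family n 2 ?F"
    unfolding dicycle_family_def
  proof (intro conjI ballI impI)
    fix H assume "H \<in> ?F"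
    then obtain S where "S \<subseteq> {..<n div 2}" "H = ?path S" by auto
    then show "directed_hamilton_path (sym_complete_digraph n) H"
      unfolding directed_hamilton_path_iff[OF assms]
      by (intro exI[of _ "block_list n S"]) (simp add: distinct_block_list set_block_list)
  next
    fix H K assume "H \<in> ?F" "K \<in> ?F" "H \<noteq> K"
    then obtain S T where "S \<subseteq> {..<n div 2}" "H = ?path S" "T \<subseteq> {..<n div 2}" "K = ?path T"
      by auto
    then show "contains_dicycle 2 (Digraph_Component.union H K)"
      using contains_dicycle_block_lists[of S n T] \<open>H \<noteq> K\<close> by auto
  qed
  \<comment> \<open>A path united with itself has no two-cycle, so different sets of blocks give different paths.\<close>
  have "inj_on ?path (Pow {..<n div 2})"
  proof (rule inj_onI, rule ccontr)
    fix S T assume "S \<in> Pow {..<n div 2}" "T \<in> Pow {..<n div 2}" "?path S = ?path T" "S \<noteq> T"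
    then have "contains_dicycle 2 (Digraph_Component.union (?path S) (?path S))"
      using contains_dicycle_block_lists[of S n T] by simp
    then show False
      using no_antiparallel_arcs[OF distinct_block_list]
      by (auto simp: contains_dicycle_2_union_iff[OF distinct_block_list distinct_block_list])
  qed
  then show "card ?F = 2 ^ (n div 2)"
    by (simp add: card_image card_Pow)
qed

theorem theorem3:
  fixes n :: nat
  assumes "n \<ge> 1"
  shows "2 ^ (n div 2) \<le> max_dicycle_family n 2 \<and> max_dicycle_family n 2 \<le> 2 ^ (n - 1)"
proof
  have fin: "finite (card ` {F. dicycle_family n 2 F})"
    by (simp add: finite_dicycle_families)
  show "2 ^ (n div 2) \<le> max_dicycle_family n 2"
    using exists_dicycle_family_of_card[OF assms] fin
    unfolding max_dicycle_family_def by (force intro!: Max_ge)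
  show "max_dicycle_family n 2 \<le> 2 ^ (n - 1)"
    unfolding max_dicycle_family_def
    using fin dicycle_family_empty card_dicycle_family_le[OF assms]
    by (subst Max_le_iff) auto
qed

end
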